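(* Let $G$ be a graph on $n$ vertices, let $N\subseteq V(G)$ be an independent set, and let $G^{N}$ be the corresponding probe graph. Then $\operatorname{M}(G^{N})\ge |N|$. Equivalently, $\operatorname{mr}(G^{N})\le n-|N|$.
   Context: Graphs are finite, simple and undirected. For a graph $G$ on vertices $v_1,\dots,v_n$, $\mathcal S(G)$ is the set of real symmetric $n\times n$ matrices whose $ij$ entry, for $i\ne j$, is nonzero if and only if $v_iv_j\in E(G)$; diagonal entries are arbitrary real numbers. A probe graph $G^{N}$ is a graph $G$ together with an independent set $N\subseteq V(G)$ (the non-probe vertices); the remaining vertices are the probe vertices. With $|N|=k$ and the vertices of $N$ ordered last, $\mathcal S(G^{N})$ is the set of matrices $A+\begin{bmatrix}O&O\\O&B\end{bmatrix}$ with $A\in\mathcal S(G)$ and $B$ any real symmetric $k\times k$ matrix. Equivalently, $\mathcal S(G^{N})$ is the union of $\mathcal S(H)$ over all graphs $H$ obtained from $G$ by adding any number of edges between vertices of $N$. $\operatorname{mr}(G^{N})$ is the minimum rank, and $\operatorname{M}(G^{N})$ the maximum nullity, of a matrix in $\mathcal S(G^{N})$. *)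

theory Defs
  imports "HOL-Analysis.Analysis"
begin

text \<open>A finite graph is given by its adjacency relation on a finite vertex type \<open>'v\<close>.
  Matrices are indexed directly by the vertices, so no ordering of the vertices is chosen.\<close>

definition simple_graph :: "('v::finite \<Rightarrow> 'v \<Rightarrow> bool) \<Rightarrow> bool" where
  "simple_graph G \<longleftrightarrow> symp G \<and> irreflp G"

definition independent_set :: "('v::finite \<Rightarrow> 'v \<Rightarrow> bool) \<Rightarrow> 'v set \<Rightarrow> bool" where
  "independent_set G N \<longleftrightarrow> (\<forall>u\<in>N. \<forall>v\<in>N. \<not> G u v)"

definition probe_graph :: "('v::finite \<Rightarrow> 'v \<Rightarrow> bool) \<Rightarrow> 'v set \<Rightarrow> bool" where
  "probe_graph G N \<longleftrightarrow> simple_graph G \<and> independent_set G N"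

definition sym_matrices :: "('v::finite \<Rightarrow> 'v \<Rightarrow> bool) \<Rightarrow> (real^'v^'v) set" where
  "sym_matrices G =
     {A. transpose A = A \<and> (\<forall>i j. i \<noteq> j \<longrightarrow> (A $ i $ j \<noteq> 0 \<longleftrightarrow> G i j))}"

text \<open>The summand \<open>B\<close> below is the full-size block matrix with an arbitrary symmetric block on
  the rows and columns in \<open>N\<close> and zeros elsewhere.\<close>

definition probe_matrices :: "('v::finite \<Rightarrow> 'v \<Rightarrow> bool) \<Rightarrow> 'v set \<Rightarrow> (real^'v^'v) set" where
  "probe_matrices G N =
     {A + B | A B. A \<in> sym_matrices G \<and> transpose B = B \<and>
        (\<forall>i j. \<not> (i \<in> N \<and> j \<in> N) \<longrightarrow> B $ i $ j = 0)}"

definition nullity :: "real^'v^'v \<Rightarrow> nat" where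
  "nullity A = dim {x. A *v x = 0}"

definition min_rank :: "('v::finite \<Rightarrow> 'v \<Rightarrow> bool) \<Rightarrow> 'v set \<Rightarrow> nat" where
  "min_rank G N = Min (rank ` probe_matrices G N)"

definition max_nullity :: "('v::finite \<Rightarrow> 'v \<Rightarrow> bool) \<Rightarrow> 'v set \<Rightarrow> nat" where
  "max_nullity G N = Max (nullity ` probe_matrices G N)"

text \<open>For a probe graph, the minimum and the maximum above are taken over finite nonempty sets.\<close>

lemma finite_rank_image: "finite (rank ` (X :: (real^'v^'v) set))"
proof (rule finite_subset)
  show "rank ` X \<subseteq> {..CARD('v)}"
    using rank_bound by fastforce
qed simp

lemma finite_nullity_image: "finite (nullity ` (X :: (real^'v^'v) set))"
proof (rule finite_subset)
  show "nullity ` X \<subseteq> {..CARD('v)}"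
    using dim_subset_UNIV_cart by (auto simp: nullity_def)
qed simp

lemma probe_matrices_nonempty:
  assumes "probe_graph G N"
  shows "probe_matrices G N \<noteq> {}"
proof -
  define A :: "real^'a^'a" where "A = (\<chi> i j. if G i j then 1 else 0)"
  have "symp G" using assms by (simp add: probe_graph_def simple_graph_def)
  then have "A \<in> sym_matrices G"
    by (auto simp: sym_matrices_def A_def transpose_def vec_eq_iff dest: sympD)
  then have "A + 0 \<in> probe_matrices G N"
    unfolding probe_matrices_def by (fastforce simp: transpose_def vec_eq_iff)
  then show ?thesis by blast
qed

end

theory Submission
  imports Defs
begin

text \<open>
  Only one matrix in \<open>probe_matrices G N\<close> of nullity at least \<open>card N\<close> is needed, and a Schur complement
  provides it. Ordering the probe vertices first, let
  \<open>A = [[P, C], [C\<^sup>T, D]]\<close> be the adjacency matrix of \<open>G\<close> with a constant diagonal that is large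
  enough for \<open>P\<close> to be strictly diagonally dominant, hence invertible (lemma
  \<open>diagonally_dominant_block_injective\<close>). The lower right block is at our disposal, so \<open>D\<close> may be
  replaced by \<open>C\<^sup>T P\<^sup>-\<^sup>1 C\<close>. The result factors as
  \<open>[[I, 0], [X\<^sup>T, I]] [[P, 0], [0, 0]] [[I, X], [0, I]]\<close> with \<open>X = P\<^sup>-\<^sup>1 C\<close>, so its rank is at most
  the number of probe vertices (lemma \<open>symmetric_completion_rank\<close>).
\<close>

text \<open>Rank-nullity: the kernel of \<open>A\<close> is the orthogonal complement of the range of \<open>transpose A\<close>.\<close>

lemma nullity_add_rank: "nullity A + rank A = CARD('n)" for A :: "real^'n^'n"
proof -
  let ?R = "range ((*v) (transpose A))"
  have adj: "(transpose A *v y) \<bullet> x = y \<bullet> (A *v x)" for x y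
    by (simp add: dot_lmul_matrix)
  have "A *v x = 0 \<longleftrightarrow> (\<forall>y. y \<bullet> (A *v x) = 0)" for x
    by (metis inner_eq_zero_iff inner_zero_right)
  then have "{x. A *v x = 0} = {x \<in> UNIV. \<forall>z\<in>?R. orthogonal z x}"
    by (simp add: orthogonal_def adj del: transpose_matrix_vector)
  moreover have "subspace ?R"
    by (intro linear_subspace_image matrix_vector_mul_linear subspace_UNIV)
  ultimately have "nullity A + dim ?R = DIM(real^'n)"
    unfolding nullity_def using dim_subspace_orthogonal_to_vectors[of ?R UNIV] by simp
  then show ?thesis
    using rank_transpose[of A] by (simp add: rank_dim_range)
qed

lemma matrix_add_rdistrib: "(A + B) ** C = A ** C + B ** C"
  for A :: "'a::semiring_1^'n^'m"
  by (simp add: vec_eq_iff matrix_matrix_mult_def sum.distrib distrib_right)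

lemma rank_le_of_zero_rows:
  fixes A :: "real^'n^'n"
  assumes "\<And>i j. i \<in> N \<Longrightarrow> A $ i $ j = 0"
  shows "rank A \<le> CARD('n) - card N"
proof -
  have "range ((*v) A) \<subseteq> {x. \<forall>i. i \<notin> - N \<longrightarrow> x $ i = 0}"
    using assms by (auto simp: matrix_vector_mult_def)
  then have "rank A \<le> dim {x :: real^'n. \<forall>i. i \<notin> - N \<longrightarrow> x $ i = 0}"
    by (simp add: rank_dim_range dim_subset)
  also have "\<dots> = card (- N)"
    by (simp only: dim_substandard_cart flip: dim_vec_eq)
  also have "\<dots> = CARD('n) - card N"
    by (simp add: Compl_eq_Diff_UNIV card_Diff_subset)
  finally show ?thesis .
qed

text \<open>An entry \<open>x $ i\<close> of maximal modulus in a nonzero vector supported off \<open>N\<close> has \<open>i \<notin> N\<close>, so the diagonal term of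
  \<open>(A *v x) $ i\<close> outweighs all the others together, which makes \<open>(A *v x) $ i\<close> nonzero.\<close>

lemma diagonally_dominant_block_injective:
  fixes A :: "real^'n^'n"
  assumes dominant: "\<And>i. i \<notin> N \<Longrightarrow> (\<Sum>j\<in>-{i}. \<bar>A $ i $ j\<bar>) < \<bar>A $ i $ i\<bar>"
    and supp: "\<And>i. i \<in> N \<Longrightarrow> x $ i = 0"
    and ker: "\<And>i. i \<notin> N \<Longrightarrow> (A *v x) $ i = 0"
  shows "x = 0"
proof (rule ccontr)
  assume "x \<noteq> 0"
  then obtain k where k: "x $ k \<noteq> 0" by (auto simp: vec_eq_iff)
  obtain i where i: "\<And>j. \<bar>x $ j\<bar> \<le> \<bar>x $ i\<bar>"
    using Max_in[of "range (\<lambda>j. \<bar>x $ j\<bar>)"] Max_ge[of "range (\<lambda>j. \<bar>x $ j\<bar>)"] by fastforce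
  have xi: "\<bar>x $ i\<bar> > 0" using i[of k] k by linarith
  then have iN: "i \<notin> N" using supp by auto
  have "0 = (\<Sum>j\<in>UNIV. A $ i $ j * x $ j)"
    using ker[OF iN] by (simp add: matrix_vector_mult_def)
  also have "\<dots> = A $ i $ i * x $ i + (\<Sum>j\<in>-{i}. A $ i $ j * x $ j)"
    by (simp add: sum.remove Compl_eq_Diff_UNIV)
  finally have "\<bar>A $ i $ i\<bar> * \<bar>x $ i\<bar> = \<bar>\<Sum>j\<in>-{i}. A $ i $ j * x $ j\<bar>"
    by (simp add: abs_mult[symmetric])
  also have "\<dots> \<le> (\<Sum>j\<in>-{i}. \<bar>A $ i $ j\<bar> * \<bar>x $ j\<bar>)"
    using sum_abs[of "\<lambda>j. A $ i $ j * x $ j"] by (simp add: abs_mult)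
  also have "\<dots> \<le> (\<Sum>j\<in>-{i}. \<bar>A $ i $ j\<bar>) * \<bar>x $ i\<bar>"
    unfolding sum_distrib_right by (intro sum_mono mult_left_mono i) auto
  also have "\<dots> < \<bar>A $ i $ i\<bar> * \<bar>x $ i\<bar>"
    using dominant[OF iN] xi by simp
  finally show False by simp
qed

text \<open>Completion by a Schur complement. The blocks are kept at full size, padded by zeros. To invert
  the block off \<open>N\<close> without a matrix type for it, the identity is placed on the block \<open>N\<close>.\<close>

lemma symmetric_completion_rank:
  fixes A :: "real^'n^'n"
  assumes sym: "transpose A = A"
    and inj: "\<And>x. (\<And>i. i \<in> N \<Longrightarrow> x $ i = 0) \<Longrightarrow> (\<And>i. i \<notin> N \<Longrightarrow> (A *v x) $ i = 0) \<Longrightarrow> x = 0"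
  obtains B where "transpose B = B" and "\<And>i j. \<not> (i \<in> N \<and> j \<in> N) \<Longrightarrow> B $ i $ j = 0"
    and "rank (A + B) \<le> CARD('n) - card N"
proof -
  have symA: "A $ i $ j = A $ j $ i" for i j
    using arg_cong[OF sym, of "\<lambda>M. M $ j $ i"] by (simp add: transpose_def)
  define P :: "real^'n^'n" where "P = (\<chi> i j. if i \<in> N \<or> j \<in> N then 0 else A $ i $ j)"
  define C :: "real^'n^'n" where "C = (\<chi> i j. if i \<notin> N \<and> j \<in> N then A $ i $ j else 0)"
  define D :: "real^'n^'n" where "D = (\<chi> i j. if i \<in> N \<and> j \<in> N then A $ i $ j else 0)"
  define E :: "real^'n^'n" where "E = (\<chi> i j. if i \<in> N \<and> i = j then 1 else 0)"
  have blocks: "A = P + C + transpose C + D"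
    by (auto simp: vec_eq_iff P_def C_def D_def transpose_def symA)
  have symP: "transpose P = P" and symD: "transpose D = D"
    by (auto simp: vec_eq_iff P_def D_def transpose_def symA)
  have Ex: "(E *v x) $ i = (if i \<in> N then x $ i else 0)" for x i
    by (simp add: E_def matrix_vector_mult_def if_distrib[where f="\<lambda>a. a * _"] cong: if_cong)
  have "x = 0" if "(P + E) *v x = 0" for x
  proof (rule inj)
    have split: "(P *v x) $ i + (E *v x) $ i = 0" for i
      using that by (simp add: vec_eq_iff matrix_vector_mult_add_rdistrib)
    show x0: "x $ i = 0" if "i \<in> N" for i
      using split[of i] that by (simp add: Ex) (simp add: P_def matrix_vector_mult_def)
    show "(A *v x) $ i = 0" if "i \<notin> N" for i
    proof -
      have "(A *v x) $ i = (P *v x) $ i"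
        unfolding matrix_vector_mult_def vec_lambda_beta
        using that x0 by (intro sum.cong) (auto simp: P_def)
      then show ?thesis using split[of i] that by (simp add: Ex)
    qed
  qed
  then obtain Q where "Q ** (P + E) = mat 1"
    using matrix_left_invertible_ker[of "P + E"] by blast
  then have Q: "(P + E) ** Q = mat 1"
    by (simp add: matrix_left_right_inverse)
  \<comment> \<open>\<open>Q\<close> inverts the padded block, so \<open>X\<close> is \<open>P\<^sup>-\<^sup>1 C\<close>. Its rows in \<open>N\<close> vanish because those of \<open>C\<close>
    do, which removes the auxiliary \<open>E\<close> from the equation.\<close>
  define X where "X = Q ** C"
  have solve: "P ** X + E ** X = C"
    by (simp add: X_def matrix_mul_assoc Q flip: matrix_add_rdistrib)
  have EXi: "(E ** X) $ i $ j = (if i \<in> N then X $ i $ j else 0)" for i j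
    by (simp add: E_def matrix_matrix_mult_def if_distrib[where f="\<lambda>a. a * _"] cong: if_cong)
  have "(E ** X) $ i $ j = 0" for i j
  proof (cases "i \<in> N")
    case True
    then show ?thesis
      using arg_cong[OF solve, of "\<lambda>M. M $ i $ j"]
      by (simp add: P_def C_def matrix_matrix_mult_def)
  qed (simp add: EXi)
  then have PX: "P ** X = C"
    using solve by (simp add: vec_eq_iff)
  have XP: "transpose X ** P = transpose C"
    using arg_cong[OF PX, of transpose] by (simp add: matrix_transpose_mul symP)
  \<comment> \<open>The Schur term \<open>C\<^sup>T P\<^sup>-\<^sup>1 C\<close>, which is to replace the block \<open>D\<close>.\<close>
  define S where "S = transpose X ** P ** X"
  have symS: "transpose S = S"
    by (simp add: S_def matrix_transpose_mul symP matrix_mul_assoc)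
  have S0: "S $ i $ j = 0" if "j \<notin> N" for i j
    using that unfolding S_def matrix_mul_assoc[symmetric] PX
    by (simp add: C_def matrix_matrix_mult_def)
  have S_supp: "S $ i $ j = 0" if "\<not> (i \<in> N \<and> j \<in> N)" for i j
    using that S0[of j i] S0[of i j] arg_cong[OF symS, of "\<lambda>M. M $ i $ j"]
    by (auto simp: transpose_def)
  have "A + (S - D) = (mat 1 + transpose X) ** P ** (mat 1 + X)"
    by (simp add: blocks matrix_add_ldistrib matrix_add_rdistrib PX XP S_def)
  then have "rank (A + (S - D)) \<le> rank P"
    by (metis rank_mul_le_left rank_mul_le_right order_trans)
  also have "\<dots> \<le> CARD('n) - card N"
    by (rule rank_le_of_zero_rows) (simp add: P_def)
  finally have rk: "rank (A + (S - D)) \<le> CARD('n) - card N" .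
  show thesis
  proof (rule that[OF _ _ rk])
    show "transpose (S - D) = S - D"
      using symS symD by (simp add: vec_eq_iff transpose_def)
    show "(S - D) $ i $ j = 0" if "\<not> (i \<in> N \<and> j \<in> N)" for i j
      using S_supp[OF that] that by (auto simp: D_def)
  qed
qed

theorem proposition2p1:
  fixes G :: "'v::finite \<Rightarrow> 'v \<Rightarrow> bool" and N :: "'v set"
  assumes "probe_graph G N"
  shows "max_nullity G N \<ge> card N \<and> min_rank G N \<le> CARD('v) - card N"
proof -
  have G: "symp G"
    using assms by (simp add: probe_graph_def simple_graph_def)
  \<comment> \<open>A row has at most \<open>CARD('v) - 1\<close> off-diagonal ones, so this diagonal dominates strictly.\<close>
  define A :: "real^'v^'v" where
    "A = (\<chi> i j. if i = j then real CARD('v) else if G i j then 1 else 0)"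
  have A: "A \<in> sym_matrices G" "transpose A = A"
    using G by (auto simp: sym_matrices_def A_def transpose_def vec_eq_iff dest: sympD)
  have dominant: "(\<Sum>j\<in>-{i}. \<bar>A $ i $ j\<bar>) < \<bar>A $ i $ i\<bar>" for i
  proof -
    have "(\<Sum>j\<in>-{i}. \<bar>A $ i $ j\<bar>) \<le> (\<Sum>j\<in>-{i}. 1)"
      by (rule sum_mono) (simp add: A_def)
    also have "\<dots> < real CARD('v)"
      by (simp add: Compl_eq_Diff_UNIV card_Diff_singleton)
    finally show ?thesis by (simp add: A_def)
  qed
  obtain B where B: "transpose B = B" "\<And>i j. \<not> (i \<in> N \<and> j \<in> N) \<Longrightarrow> B $ i $ j = 0"
    and rk: "rank (A + B) \<le> CARD('v) - card N"
    using symmetric_completion_rank[OF A(2), of N]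
      diagonally_dominant_block_injective[OF dominant] by metis
  have M: "A + B \<in> probe_matrices G N"
    using A(1) B unfolding probe_matrices_def by blast
  have "min_rank G N \<le> rank (A + B)"
    unfolding min_rank_def using M by (simp add: finite_rank_image)
  moreover have "nullity (A + B) \<le> max_nullity G N"
    unfolding max_nullity_def using M by (simp add: finite_nullity_image)
  moreover have "card N \<le> nullity (A + B)"
    using rk card_mono[of UNIV N] nullity_add_rank[of "A + B"] by simp
  ultimately show ?thesis
    using rk by linarith
qed

end
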